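(* Let $k\in\{0,1,\ldots,k_{\max}\}$ and suppose $\|s_{opt}\|=\|s_k\|=\Delta$. Then $$0\le q(s_k)-q(s_{opt})\le 8(\alpha_1+\lambda_{opt})\Delta^2\left(\frac{\sqrt\kappa-1}{\sqrt\kappa+1}\right)^{2(k+1)},$$ where $\kappa=\frac{\alpha_1+\lambda_{opt}}{\alpha_n+\lambda_{opt}}$.
   Context: $\|\cdot\|$ is the 2-norm. $A\in\mathbb R^{n\times n}$ is symmetric and nonsingular with eigenvalues $\alpha_1\ge\alpha_2\ge\cdots\ge\alpha_n$, $g\in\mathbb R^n$ is nonzero, $\Delta>0$, and $q(s)=g^Ts+\frac12 s^TAs$. The trust-region subproblem (TRS) is $\min_{\|s\|\le\Delta}q(s)$; $s_{opt}$ is its solution and $\lambda_{opt}\ge0$ its optimal Lagrangian multiplier: $\|s_{opt}\|\le\Delta$, $(A+\lambda_{opt}I)s_{opt}=-g$, $\lambda_{opt}(\Delta-\|s_{opt}\|)=0$, $A+\lambda_{opt}I\succeq0$. Standing assumption (easy case): $A+\lambda_{opt}I\succ0$, so $s_{opt}$ is unique. $\mathcal K_k(g,A)=\mathrm{span}\{g,Ag,\ldots,A^kg\}$; $k_{\max}$ is the largest $k$ with $\dim\mathcal K_k(g,A)=k+1$ (the first iteration at which the symmetric Lanczos process breaks down). $s_k$ is the solution of the projected problem $\min_{s\in\mathcal K_k(g,A),\ \|s\|\le\Delta}q(s)$, with optimal Lagrangian multiplier $\lambda_k$. Standing assumption: $\|s_k\|=\Delta$ and $\lambda_k>0$ for all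 $k=0,\ldots,k_{\max}$. *)

theory Defs
  imports "HOL-Analysis.Analysis"
begin

definition pos_semidef :: "real^'n^'n \<Rightarrow> bool" where
  "pos_semidef M \<longleftrightarrow> transpose M = M \<and> (\<forall>x. 0 \<le> x \<bullet> (M *v x))"

definition pos_def :: "real^'n^'n \<Rightarrow> bool" where
  "pos_def M \<longleftrightarrow> transpose M = M \<and> (\<forall>x. x \<noteq> 0 \<longrightarrow> 0 < x \<bullet> (M *v x))"

text \<open>
  The values \<open>\<alpha> 1 \<ge> \<dots> \<ge> \<alpha> n\<close> are all the eigenvalues of \<open>M\<close>, repeated according to
  multiplicity: the characteristic polynomial is \<open>\<Prod>i. (x - \<alpha> i)\<close>. Only the values of
  \<open>\<alpha>\<close> on \<open>{1..n}\<close> matter; \<open>mat x\<close> is \<open>x\<close> times the identity.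
\<close>

definition ordered_eigenvalues :: "real^'n^'n \<Rightarrow> (nat \<Rightarrow> real) \<Rightarrow> bool" where
  "ordered_eigenvalues M \<alpha> \<longleftrightarrow>
     (\<forall>x. det (mat x - M) = (\<Prod>i = 1..CARD('n). (x - \<alpha> i))) \<and>
     (\<forall>i j. 1 \<le> i \<and> i \<le> j \<and> j \<le> CARD('n) \<longrightarrow> \<alpha> j \<le> \<alpha> i)"

definition trs_obj :: "real^'n^'n \<Rightarrow> real^'n \<Rightarrow> real^'n \<Rightarrow> real" where
  "trs_obj A g s = g \<bullet> s + 1 / 2 * (s \<bullet> (A *v s))"

text \<open>
  Minimisers of the objective over the part of the ball of radius \<open>\<Delta>\<close> lying in \<open>V\<close>:
  \<open>V = UNIV\<close> is the trust-region subproblem itself, a Krylov space \<open>V\<close> gives the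
  projected one.
\<close>

definition trs_solution ::
  "real^'n^'n \<Rightarrow> real^'n \<Rightarrow> real \<Rightarrow> (real^'n) set \<Rightarrow> real^'n \<Rightarrow> bool" where
  "trs_solution A g \<Delta> V s \<longleftrightarrow>
     s \<in> V \<and> norm s \<le> \<Delta> \<and>
     (\<forall>t\<in>V. norm t \<le> \<Delta> \<longrightarrow> trs_obj A g s \<le> trs_obj A g t)"

definition trs_multiplier ::
  "real^'n^'n \<Rightarrow> real^'n \<Rightarrow> real \<Rightarrow> real^'n \<Rightarrow> real \<Rightarrow> bool" where
  "trs_multiplier A g \<Delta> s \<mu> \<longleftrightarrow>
     0 \<le> \<mu> \<and> norm s \<le> \<Delta> \<and> (A + mat \<mu>) *v s = - g \<and>
     \<mu> * (\<Delta> - norm s) = 0 \<and> pos_semidef (A + mat \<mu>)"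

text \<open>
  The same optimality conditions for the problem restricted to a subspace \<open>V\<close>. For a matrix
  \<open>Q\<close> whose columns are an orthonormal basis of \<open>V\<close> and \<open>s = Q h\<close>, \<open>T = Q\<^sup>T A Q\<close>, they are the
  conditions \<open>(T + \<mu> I) h = - Q\<^sup>T g\<close>, \<open>\<mu> (\<Delta> - \<parallel>h\<parallel>) = 0\<close> and \<open>T + \<mu> I \<succeq> 0\<close> of the reduced
  problem, written without choosing \<open>Q\<close>.
\<close>

definition trs_multiplier_on ::
  "(real^'n) set \<Rightarrow> real^'n^'n \<Rightarrow> real^'n \<Rightarrow> real \<Rightarrow> real^'n \<Rightarrow> real \<Rightarrow> bool" where
  "trs_multiplier_on V A g \<Delta> s \<mu> \<longleftrightarrow>
     0 \<le> \<mu> \<and> s \<in> V \<and> norm s \<le> \<Delta> \<and>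
     (\<forall>v\<in>V. v \<bullet> ((A + mat \<mu>) *v s + g) = 0) \<and>
     \<mu> * (\<Delta> - norm s) = 0 \<and>
     (\<forall>v\<in>V. 0 \<le> v \<bullet> ((A + mat \<mu>) *v v))"

lemma trs_multiplier_on_UNIV:
  fixes A :: "real^'n^'n"
  assumes "transpose A = A"
  shows "trs_multiplier_on UNIV A g \<Delta> s \<mu> \<longleftrightarrow> trs_multiplier A g \<Delta> s \<mu>"
proof -
  have "transpose (A + mat \<mu>) = A + mat \<mu>"
    using assms by (auto simp: transpose_def mat_def vec_eq_iff)
  moreover have "(\<forall>v. v \<bullet> ((A + mat \<mu>) *v s + g) = 0) \<longleftrightarrow> (A + mat \<mu>) *v s = - g"
    by (metis add_eq_0_iff2 inner_eq_zero_iff inner_zero_right)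
  ultimately show ?thesis
    by (auto simp: trs_multiplier_on_def trs_multiplier_def pos_semidef_def)
qed

definition krylov :: "real^'n^'n \<Rightarrow> real^'n \<Rightarrow> nat \<Rightarrow> (real^'n) set" where
  "krylov A g k = span ((\<lambda>i. ((*v) A ^^ i) g) ` {0..k})"

definition lanczos_kmax :: "real^'n^'n \<Rightarrow> real^'n \<Rightarrow> nat" where
  "lanczos_kmax A g = (GREATEST k. dim (krylov A g k) = k + 1)"

text \<open>For \<open>g \<noteq> 0\<close> the maximum is attained, so \<open>GREATEST\<close> is meaningful.\<close>

lemma lanczos_kmax:
  fixes A :: "real^'n^'n"
  assumes "g \<noteq> 0"
  shows "dim (krylov A g (lanczos_kmax A g)) = lanczos_kmax A g + 1"
    and "dim (krylov A g k) = k + 1 \<Longrightarrow> k \<le> lanczos_kmax A g"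
proof -
  have bound: "k \<le> CARD('n)" if "dim (krylov A g k) = k + 1" for k
    using dim_subset_UNIV_cart[of "krylov A g k"] that by simp
  have zero: "dim (krylov A g 0) = 0 + 1"
    using assms by (simp add: krylov_def)
  show "dim (krylov A g (lanczos_kmax A g)) = lanczos_kmax A g + 1"
    unfolding lanczos_kmax_def
    by (rule GreatestI_nat[where P = "\<lambda>k. dim (krylov A g k) = k + 1", OF zero bound])
  show "k \<le> lanczos_kmax A g" if "dim (krylov A g k) = k + 1"
    unfolding lanczos_kmax_def
    by (rule Greatest_le_nat[where P = "\<lambda>k. dim (krylov A g k) = k + 1", OF that bound])
qed

end

theory Submission
  imports Defs "HOL-Computational_Algebra.Polynomial"
begin

text \<open>
  With \<open>B = A + \<mu>\<^sub>o\<^sub>p\<^sub>t I\<close> one has \<open>g = - B s\<^sub>o\<^sub>p\<^sub>t\<close>, so on the sphere of radius \<open>\<Delta>\<close> the gap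
  \<open>q u - q s\<^sub>o\<^sub>p\<^sub>t\<close> is half the squared \<open>B\<close>-norm of \<open>u - s\<^sub>o\<^sub>p\<^sub>t\<close>. Since \<open>s\<^sub>k\<close> is optimal in the Krylov
  space, any \<open>u\<close> of norm \<open>\<Delta>\<close> in that space bounds the gap from above. Take a polynomial \<open>r\<close> of degree
  at most \<open>k + 1\<close> with \<open>r 0 = 1\<close>: then \<open>v = s\<^sub>o\<^sub>p\<^sub>t - r(B) s\<^sub>o\<^sub>p\<^sub>t\<close> lies in the Krylov space, and a rescaled
  Chebyshev polynomial makes \<open>\<parallel>v - s\<^sub>o\<^sub>p\<^sub>t\<parallel>\<close> at most \<open>2 \<Delta>\<close> times the \<open>k + 1\<close>-st power of
  \<open>(sqrt \<kappa> - 1) / (sqrt \<kappa> + 1)\<close>. Rescaling \<open>v\<close> to norm \<open>\<Delta>\<close> at most doubles this distance, because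
  \<open>\<bar>\<Delta> - \<parallel>v\<parallel>\<bar> \<le> \<parallel>v - s\<^sub>o\<^sub>p\<^sub>t\<parallel>\<close>.
\<close>

section \<open>The spectral theorem for self-adjoint operators\<close>

text \<open>Perturb \<open>v\<close> along \<open>u\<close>: the form at
  \<open>v + t *\<^sub>R u\<close> is \<open>2 * t * c + t\<^sup>2 * d\<close>, which a nonzero
  \<open>c\<close> makes negative for a suitable \<open>t\<close>.\<close>

lemma psd_form_eq_zero_imp_orthogonal:
  fixes h :: "'a::real_inner \<Rightarrow> 'a"
  assumes "linear h" and V: "subspace V"
    and sa: "\<And>x y. x \<in> V \<Longrightarrow> y \<in> V \<Longrightarrow> h x \<bullet> y = x \<bullet> h y"
    and psd: "\<And>x. x \<in> V \<Longrightarrow> 0 \<le> x \<bullet> h x"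
    and v: "v \<in> V" "v \<bullet> h v = 0" and u: "u \<in> V"
  shows "u \<bullet> h v = 0"
proof (rule ccontr)
  interpret linear h by fact
  assume ne: "u \<bullet> h v \<noteq> 0"
  define c d where "c = u \<bullet> h v" and "d = u \<bullet> h u"
  have d: "0 \<le> d" using psd u by (simp add: d_def)
  \<comment> \<open>The quadratic is minimal at \<open>- c / d\<close>; the denominator
    \<open>d + 1\<close> also covers \<open>d = 0\<close>.\<close>
  define t where "t = - c / (d + 1)"
  have "0 \<le> (v + t *\<^sub>R u) \<bullet> h (v + t *\<^sub>R u)"
    by (intro psd subspace_add subspace_scale V u v)
  also have "\<dots> = 2 * t * c + t\<^sup>2 * d"
    using v sa[OF v(1) u]
    by (simp add: add scale inner_add_left inner_add_right c_def d_def power2_eq_square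
        inner_commute algebra_simps)
  also have "\<dots> = - (t\<^sup>2 * (d + 2))"
  proof -
    have "c = - t * (d + 1)"
      using d by (simp add: t_def)
    then show ?thesis
      by (simp only:) (simp add: algebra_simps power2_eq_square)
  qed
  also have "\<dots> < 0"
    using d ne by (simp add: t_def c_def)
  finally show False by simp
qed

lemma self_adjoint_eigenvector:
  fixes f :: "'a::euclidean_space \<Rightarrow> 'a"
  assumes f: "linear f" and V: "subspace V" "V \<noteq> {0}"
    and inv: "\<And>x. x \<in> V \<Longrightarrow> f x \<in> V"
    and sa: "\<And>x y. x \<in> V \<Longrightarrow> y \<in> V \<Longrightarrow> f x \<bullet> y = x \<bullet> f y"
  obtains v l where "v \<in> V" "norm v = 1" "f v = l *\<^sub>R v"
proof -
  interpret linear f by fact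
  obtain w where w: "w \<in> V" "w \<noteq> 0"
    using V subspace_0 by blast
  have "compact (sphere 0 1 \<inter> V)"
    by (intro compact_Int_closed closed_subspace V compact_sphere)
  moreover have "w /\<^sub>R norm w \<in> sphere 0 1 \<inter> V"
    using w V by (auto intro: subspace_scale)
  moreover have "continuous_on (sphere 0 1 \<inter> V) (\<lambda>x. x \<bullet> f x)"
    by (intro continuous_intros linear_continuous_on linear_conv_bounded_linear[THEN iffD1] f)
  ultimately obtain v where v: "v \<in> V" "norm v = 1"
    and max: "\<And>x. x \<in> V \<Longrightarrow> norm x = 1 \<Longrightarrow> x \<bullet> f x \<le> v \<bullet> f v"
    using continuous_attains_sup[of "sphere 0 1 \<inter> V" "\<lambda>x. x \<bullet> f x"]
    by (metis IntE IntI empty_iff mem_sphere_0)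
  \<comment> \<open>\<open>l\<close> is the maximal Rayleigh quotient, so \<open>h\<close> is positive semidefinite with null vector \<open>v\<close>.\<close>
  define l where "l = v \<bullet> f v"
  define h where "h x = l *\<^sub>R x - f x" for x
  have vv: "v \<bullet> v = 1" using v by (simp add: norm_eq_1)
  have hV: "h x \<in> V" if "x \<in> V" for x
    unfolding h_def by (intro subspace_diff subspace_scale V inv that)
  have psd: "0 \<le> x \<bullet> h x" if "x \<in> V" for x
  proof (cases "x = 0")
    case False
    have "(x /\<^sub>R norm x) \<bullet> f (x /\<^sub>R norm x) \<le> l"
      unfolding l_def using that False V by (intro max subspace_scale) auto
    then have "x \<bullet> f x \<le> l * (norm x * norm x)"
      using False by (simp add: scale field_simps)
    then show ?thesis
      by (simp add: h_def inner_diff_right dot_square_norm power2_eq_square)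
  qed auto
  \<comment> \<open>Since \<open>h v\<close> lies in \<open>V\<close>, it may itself be the vector
    tested against \<open>h v\<close>.\<close>
  have "h v \<bullet> h v = 0"
  proof (rule psd_form_eq_zero_imp_orthogonal[OF _ V(1) _ psd v(1) _ hV[OF v(1)]])
    show "linear h"
      unfolding h_def by (intro linear_compose_sub linear_scale_self f)
    show "h x \<bullet> y = x \<bullet> h y" if "x \<in> V" "y \<in> V" for x y
      using sa[OF that] by (simp add: h_def inner_diff_left inner_diff_right)
    show "v \<bullet> h v = 0"
      using vv by (simp add: h_def inner_diff_right l_def)
  qed
  then have "f v = l *\<^sub>R v" by (simp add: h_def)
  with v that show thesis by blast
qed

text \<open>An invariant subspace \<open>V\<close> is allowed so that induction on the dimension can
  pass to the orthogonal complement \<open>W\<close> in \<open>V\<close> of a unit eigenvector;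
  self-adjointness makes \<open>W\<close> invariant again.\<close>

theorem self_adjoint_orthonormal_eigenbasis:
  fixes f :: "'a::euclidean_space \<Rightarrow> 'a"
  assumes f: "linear f" and "subspace V"
    and "\<And>x. x \<in> V \<Longrightarrow> f x \<in> V"
    and "\<And>x y. x \<in> V \<Longrightarrow> y \<in> V \<Longrightarrow> f x \<bullet> y = x \<bullet> f y"
  shows "\<exists>E. finite E \<and> pairwise orthogonal E \<and> span E = V \<and>
    (\<forall>e\<in>E. norm e = 1 \<and> (\<exists>l. f e = l *\<^sub>R e))"
  using assms(2-)
proof (induction "dim V" arbitrary: V rule: less_induct)
  case less
  note V = less.prems(1) and inv = less.prems(2) and sa = less.prems(3)
  interpret linear f by fact
  show ?case
  proof (cases "V = {0}")
    case True
    then show ?thesis by (intro exI[of _ "{}"]) auto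
  next
    case False
    obtain v l where v: "v \<in> V" "norm v = 1" "f v = l *\<^sub>R v"
      using self_adjoint_eigenvector[OF f V False inv sa] by blast
    have vv: "v \<bullet> v = 1" using v by (simp add: norm_eq_1)
    define W where "W = V \<inter> {x. v \<bullet> x = 0}"
    have W: "subspace W"
      unfolding W_def by (intro subspace_inter V subspace_hyperplane)
    have "v \<notin> W" using vv by (simp add: W_def)
    then have "W \<subset> V" using v(1) W_def by blast
    then have "span W \<subset> span V"
      using W V by (simp only: span_eq_iff[THEN iffD2])
    then have "dim W < dim V" by (rule dim_psubset)
    moreover have "f x \<in> W" if "x \<in> W" for x
      using that sa[OF v(1), of x] inv v by (simp add: W_def)
    moreover have "f x \<bullet> y = x \<bullet> f y" if "x \<in> W" "y \<in> W" for x y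
      using that sa by (simp add: W_def)
    ultimately have "\<exists>E. finite E \<and> pairwise orthogonal E \<and> span E = W \<and>
        (\<forall>e\<in>E. norm e = 1 \<and> (\<exists>l. f e = l *\<^sub>R e))"
      by (intro less.hyps[OF _ W])
    then obtain E where E: "finite E" "pairwise orthogonal E" "span E = W"
      "\<And>e. e \<in> E \<Longrightarrow> norm e = 1 \<and> (\<exists>l. f e = l *\<^sub>R e)"
      by blast
    have EW: "E \<subseteq> W" using E(3) span_superset by blast
    have "span (insert v E) = V"
    proof
      show "span (insert v E) \<subseteq> V"
        using EW v V by (intro span_minimal) (auto simp: W_def)
      show "V \<subseteq> span (insert v E)"
      proof
        fix x assume "x \<in> V"
        then have "x - (v \<bullet> x) *\<^sub>R v \<in> W"
          using v V vv by (simp add: W_def inner_diff_right subspace_diff subspace_scale)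
        then show "x \<in> span (insert v E)"
          using E(3) span_insert by blast
      qed
    qed
    moreover have "pairwise orthogonal (insert v E)"
      using E(2) EW by (auto simp: pairwise_insert W_def orthogonal_def inner_commute)
    ultimately show ?thesis
      using E v by (intro exI[of _ "insert v E"]) auto
  qed
qed

lemma parseval_orthonormal_basis:
  fixes x :: "'a::real_inner"
  assumes "finite E" "pairwise orthogonal E" "\<And>e. e \<in> E \<Longrightarrow> norm e = 1" "x \<in> span E"
  shows "(norm x)\<^sup>2 = (\<Sum>e\<in>E. (e \<bullet> x)\<^sup>2)"
proof -
  have "pairwise (\<lambda>a b. orthogonal ((a \<bullet> x) *\<^sub>R a) ((b \<bullet> x) *\<^sub>R b)) E"
    using assms(2) by (rule pairwise_ortho_scaleR)
  then have "(norm (\<Sum>e\<in>E. (e \<bullet> x) *\<^sub>R e))\<^sup>2 = (\<Sum>e\<in>E. (norm ((e \<bullet> x) *\<^sub>R e))\<^sup>2)"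
    by (rule norm_sum_Pythagorean[OF assms(1)])
  moreover have "(\<Sum>e\<in>E. (e \<bullet> x) *\<^sub>R e) = x"
    using orthonormal_basis_expand[OF assms(2,3,4,1)] by (simp add: inner_commute)
  ultimately show ?thesis
    by (simp add: assms(3))
qed

section \<open>Symmetric matrices and their ordered eigenvalues\<close>

lemma symmetric_matrix_eigenbasis:
  fixes A :: "real^'n^'n"
  assumes "transpose A = A"
  obtains E l where "finite E" "pairwise orthogonal E" "span E = UNIV"
    "\<And>e. e \<in> E \<Longrightarrow> norm e = 1" "\<And>e. e \<in> E \<Longrightarrow> A *v e = l e *\<^sub>R e"
proof -
  have "(A *v x) \<bullet> y = x \<bullet> (A *v y)" for x y
    by (metis assms dot_lmul_matrix vector_transpose_matrix)
  then have "\<exists>E. finite E \<and> pairwise orthogonal E \<and> span E = UNIV \<and>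
      (\<forall>e\<in>E. norm e = 1 \<and> (\<exists>l. A *v e = l *\<^sub>R e))"
    by (intro self_adjoint_orthonormal_eigenbasis) auto
  then show thesis
    using that by metis
qed

lemma mat_scaleR_vec: "mat c *v x = c *\<^sub>R (x :: real^'n)"
  by (simp add: matrix_vector_mult_def mat_def vec_eq_iff if_distrib[of "\<lambda>y. y * _"] cong: if_cong)

lemma det_mat_minus_eq_0_iff:
  fixes A :: "real^'n^'n"
  shows "det (mat c - A) = 0 \<longleftrightarrow> (\<exists>x. x \<noteq> 0 \<and> A *v x = c *\<^sub>R x)"
proof -
  have "det (mat c - A) \<noteq> 0 \<longleftrightarrow> (\<forall>x. (mat c - A) *v x = 0 \<longrightarrow> x = 0)"
    by (simp only: invertible_det_nz[symmetric] invertible_left_inverse matrix_left_invertible_ker)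
  then show ?thesis
    by (auto simp: matrix_vector_mult_diff_rdistrib mat_scaleR_vec)
qed

text \<open>An eigenvalue is a root of the characteristic polynomial, hence equals one of the
  ordered \<open>\<alpha> i\<close>.\<close>

lemma ordered_eigenvalues_bounds:
  fixes A :: "real^'n^'n"
  assumes "ordered_eigenvalues A \<alpha>" "A *v x = c *\<^sub>R x" "x \<noteq> 0"
  shows "\<alpha> (CARD('n)) \<le> c" "c \<le> \<alpha> 1"
proof -
  have "det (mat c - A) = 0"
    using assms det_mat_minus_eq_0_iff by blast
  then obtain i where "i \<in> {1..CARD('n)}" "c = \<alpha> i"
    using assms(1) by (auto simp: ordered_eigenvalues_def)
  then show "\<alpha> (CARD('n)) \<le> c" "c \<le> \<alpha> 1"
    using assms(1) by (auto simp: ordered_eigenvalues_def)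
qed

text \<open>The last factor of the characteristic polynomial vanishes at
  \<open>\<alpha> (CARD('n))\<close>, so the shifted matrix is singular there.\<close>

lemma ordered_eigenvalues_last_eigenvector:
  fixes A :: "real^'n^'n"
  assumes "ordered_eigenvalues A \<alpha>"
  obtains x where "x \<noteq> 0" "A *v x = \<alpha> (CARD('n)) *\<^sub>R x"
proof -
  have "CARD('n) \<in> {1..CARD('n)}" by simp
  then have "(\<Prod>i = 1..CARD('n). (\<alpha> (CARD('n)) - \<alpha> i)) = 0"
    by (intro prod_zero) force+
  then have "det (mat (\<alpha> (CARD('n))) - A) = 0"
    using assms by (simp add: ordered_eigenvalues_def)
  then show thesis
    using det_mat_minus_eq_0_iff that by blast
qed

section \<open>Chebyshev polynomials\<close>

fun chebyshev :: "nat \<Rightarrow> real poly" where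
  "chebyshev 0 = 1"
| "chebyshev (Suc 0) = [:0, 1:]"
| "chebyshev (Suc (Suc n)) = [:0, 2:] * chebyshev (Suc n) - chebyshev n"

lemma degree_chebyshev_le: "degree (chebyshev n) \<le> n"
proof (induction n rule: chebyshev.induct)
  case (3 n)
  have "degree ([:0, 2:] * chebyshev (Suc n)) \<le> degree [:0, 2::real:] + degree (chebyshev (Suc n))"
    by (rule degree_mult_le)
  with 3 show ?case
    by (auto intro!: degree_diff_le simp del: mult_pCons_left)
qed auto

lemma poly_chebyshev_cos: "poly (chebyshev n) (cos t) = cos (real n * t)"
proof (induction n rule: chebyshev.induct)
  case (3 n)
  have "cos (real (Suc (Suc n)) * t) = cos (real (Suc n) * t + t)"
    and "cos (real n * t) = cos (real (Suc n) * t - t)"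
    by (simp_all add: algebra_simps)
  with 3 show ?case
    by (simp only: chebyshev.simps poly_diff poly_mult) (simp add: cos_add cos_diff)
qed auto

lemma abs_poly_chebyshev_le_1: "\<bar>x\<bar> \<le> 1 \<Longrightarrow> \<bar>poly (chebyshev n) x\<bar> \<le> 1"
  using poly_chebyshev_cos[of n "arccos x"] by (simp add: cos_arccos_abs)

text \<open>The analogue of the cosine formula outside [-1, 1], with \<open>y\<close> in place of
  exp(i t); it makes the growth in \<open>n\<close> explicit.\<close>

lemma poly_chebyshev_joukowski:
  assumes "y \<noteq> 0"
  shows "poly (chebyshev n) ((y + inverse y) / 2) = (y ^ n + inverse y ^ n) / 2"
proof (induction n rule: chebyshev.induct)
  case (3 n)
  have "(y + inverse y) * (y ^ Suc n + inverse y ^ Suc n)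
      = y ^ Suc (Suc n) + inverse y ^ Suc (Suc n) + (y * inverse y) * (y ^ n + inverse y ^ n)"
    by (simp add: algebra_simps)
  with 3 assms show ?case
    by (simp only: chebyshev.simps poly_diff poly_mult) (simp add: field_simps)
qed auto

text \<open>The affine map \<open>(a + b - 2 * x) / (a - b)\<close> sends \<open>{b..a}\<close> to
  [-1, 1] and 0 to a point beyond 1. Dividing the Chebyshev polynomial by its large value
  \<open>D\<close> at that point gives \<open>r\<close>.\<close>

lemma chebyshev_small_polynomial:
  fixes a b :: real
  assumes b: "0 < b" and ba: "b \<le> a"
  defines "\<kappa> \<equiv> a / b"
  shows "\<exists>r. degree r \<le> Suc k \<and> poly r 0 = 1 \<and>
    (\<forall>x\<in>{b..a}. \<bar>poly r x\<bar> \<le> 2 * ((sqrt \<kappa> - 1) / (sqrt \<kappa> + 1)) ^ Suc k)"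
proof (cases "a = b")
  case True
  \<comment> \<open>Here \<open>\<kappa> = 1\<close>, so the bound is 0, and 1 - x / a vanishes at
    the only point of the interval.\<close>
  with b show ?thesis
    by (intro exI[of _ "[:1, - 1 / a:]"]) (auto simp: \<kappa>_def)
next
  case False
  with ba have ab: "b < a" by simp
  \<comment> \<open>This \<open>y\<close> is the reciprocal of the convergence factor and solves
    \<open>(y + inverse y) / 2 = (a + b) / (a - b)\<close>.\<close>
  define y where "y = (sqrt a + sqrt b) / (sqrt a - sqrt b)"
  have pos: "0 < sqrt b" "sqrt b < sqrt a" using ab b by auto
  have sq: "a = sqrt a * sqrt a" "b = sqrt b * sqrt b" using ab b by auto
  have y: "0 < y" unfolding y_def using pos by (intro divide_pos_pos) linarith+
  have "sqrt \<kappa> = sqrt a / sqrt b" by (simp add: \<kappa>_def real_sqrt_divide)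
  then have "sqrt \<kappa> - 1 = (sqrt a - sqrt b) / sqrt b" "sqrt \<kappa> + 1 = (sqrt a + sqrt b) / sqrt b"
    using pos(1) by (simp_all add: diff_divide_distrib add_divide_distrib)
  then have rho: "(sqrt \<kappa> - 1) / (sqrt \<kappa> + 1) = inverse y"
    using pos(1) by (simp add: y_def)
  have "(y + inverse y) / 2 = (sqrt a * sqrt a + sqrt b * sqrt b) / (sqrt a * sqrt a - sqrt b * sqrt b)"
  proof -
    have "sqrt a * sqrt a - sqrt b * sqrt b = (sqrt a - sqrt b) * (sqrt a + sqrt b)"
      by (simp add: algebra_simps)
    then show ?thesis using pos
      by (simp add: y_def divide_simps) (simp add: algebra_simps)
  qed
  then have w: "(a + b) / (a - b) = (y + inverse y) / 2"
    by (simp only: sq[symmetric])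
  define D where "D = poly (chebyshev (Suc k)) ((a + b) / (a - b))"
  \<comment> \<open>Dropping the positive term \<open>inverse y ^ Suc k / 2\<close> leaves the
    factor 2 in the final estimate.\<close>
  have D: "y ^ Suc k / 2 \<le> D"
    unfolding D_def w poly_chebyshev_joukowski[OF less_imp_neq[OF y, symmetric]]
    using y by simp
  have Dpos: "0 < D" using D y by (smt (verit) half_gt_zero zero_less_power)
  define r where
    "r = smult (inverse D) (pcompose (chebyshev (Suc k)) [:(a + b) / (a - b), - 2 / (a - b):])"
  have pr: "poly r x = inverse D * poly (chebyshev (Suc k)) ((a + b - 2 * x) / (a - b))" for x
    by (simp add: r_def poly_pcompose diff_divide_distrib mult.commute)
  have "degree r \<le> Suc k"
  proof -
    have "degree (pcompose (chebyshev (Suc k)) [:(a + b) / (a - b), - 2 / (a - b):])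
        \<le> degree (chebyshev (Suc k)) * degree [:(a + b) / (a - b), - 2 / (a - b):]"
      by (rule degree_pcompose_le)
    also have "\<dots> \<le> Suc k * 1"
      by (intro mult_mono degree_chebyshev_le) auto
    finally show ?thesis
      using Dpos by (simp add: r_def)
  qed
  moreover have "poly r 0 = 1"
    using Dpos by (simp add: pr D_def)
  moreover have "\<bar>poly r x\<bar> \<le> 2 * inverse y ^ Suc k" if "x \<in> {b..a}" for x
  proof -
    have "\<bar>(a + b - 2 * x) / (a - b)\<bar> \<le> 1"
      using that ab by (auto simp: abs_le_iff field_simps)
    then have "\<bar>poly r x\<bar> \<le> inverse D * 1"
      unfolding pr abs_mult using Dpos
      by (intro mult_mono abs_poly_chebyshev_le_1) auto
    also have "\<dots> \<le> inverse (y ^ Suc k / 2)"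
      using D y by (simp only: mult_1_right) (intro le_imp_inverse_le, auto)
    finally show ?thesis
      by (simp add: power_inverse field_simps)
  qed
  ultimately show ?thesis
    unfolding rho by blast
qed

section \<open>Approximation in Krylov spaces and the error bound\<close>

lemma inner_eigenvector_matrix_power:
  fixes A :: "real^'n^'n"
  assumes "transpose A = A" "A *v e = l *\<^sub>R e"
  shows "e \<bullet> ((*v) A ^^ i) x = l ^ i * (e \<bullet> x)"
proof (induction i)
  case (Suc i)
  have "e \<bullet> ((*v) A ^^ Suc i) x = (A *v e) \<bullet> ((*v) A ^^ i) x"
    using assms(1) by simp (metis dot_lmul_matrix vector_transpose_matrix)
  with Suc assms(2) show ?case by simp
qed simp

text \<open>With B = A + \<mu> I and r(t) = 1 + t p(t), the vector v = p(B) g satisfies v - x = -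
  r(B) x because g = - B x. In an orthonormal eigenbasis each coordinate of x is thus multiplied by
  a number of modulus at most \<open>M\<close>.\<close>

lemma krylov_polynomial_approximation:
  fixes A :: "real^'n^'n"
  assumes sym: "transpose A = A"
    and eq: "(A + mat \<mu>) *v x = - g"
    and spec: "\<And>e l. e \<noteq> 0 \<Longrightarrow> A *v e = l *\<^sub>R e \<Longrightarrow> \<bar>poly r (l + \<mu>)\<bar> \<le> M"
    and r: "degree r \<le> Suc k" "poly r 0 = 1"
  shows "\<exists>v\<in>krylov A g k. norm (v - x) \<le> M * norm x"
proof -
  obtain E l where E: "finite E" "pairwise orthogonal E" "span E = UNIV"
    "\<And>e. e \<in> E \<Longrightarrow> norm e = 1" and l: "\<And>e. e \<in> E \<Longrightarrow> A *v e = l e *\<^sub>R e"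
    by (rule symmetric_matrix_eigenbasis[OF sym]) blast
  obtain p where p: "r = pCons 1 p"
    using r(2) by (cases r) auto
  then have "degree p \<le> k"
    using r(1) by (cases "p = 0") auto
  \<comment> \<open>\<open>P(A) = p(A + \<mu> I)\<close> and \<open>r(x) = 1 + x p(x)\<close>\<close>
  define P where "P = pcompose p [:\<mu>, 1:]"
  have "degree P \<le> degree p * 1"
    unfolding P_def by (rule order_trans[OF degree_pcompose_le]) auto
  with \<open>degree p \<le> k\<close> have degP: "degree P \<le> k" by simp
  define v where "v = (\<Sum>i\<le>degree P. coeff P i *\<^sub>R ((*v) A ^^ i) g)"
  have "v \<in> krylov A g k"
    unfolding v_def krylov_def using degP
    by (intro span_sum span_scale span_base) auto
  moreover have "norm (v - x) \<le> M * norm x"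
  proof -
    have comp: "\<bar>e \<bullet> (v - x)\<bar> \<le> \<bar>M * (e \<bullet> x)\<bar>" if e: "e \<in> E" for e
    proof -
      have ex: "e \<bullet> g = - ((l e + \<mu>) * (e \<bullet> x))"
      proof -
        have "- (e \<bullet> g) = e \<bullet> (A *v x) + \<mu> * (e \<bullet> x)"
          using arg_cong[OF eq, of "(\<bullet>) e"]
          by (simp add: matrix_vector_mult_add_rdistrib mat_scaleR_vec inner_add_right)
        with inner_eigenvector_matrix_power[OF sym l[OF e], of 1 x] show ?thesis
          by (simp add: algebra_simps)
      qed
      have "e \<bullet> v = (\<Sum>i\<le>degree P. coeff P i * (l e ^ i * (e \<bullet> g)))"
        by (simp only: v_def inner_sum_right inner_scaleR_right
            inner_eigenvector_matrix_power[OF sym l[OF e]])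
      then have "e \<bullet> v = poly P (l e) * (e \<bullet> g)"
        by (simp only: poly_altdef sum_distrib_right mult.assoc)
      then have "e \<bullet> (v - x) = - (poly r (l e + \<mu>) * (e \<bullet> x))"
        by (simp add: inner_diff_right ex P_def poly_pcompose p algebra_simps)
      moreover have "\<bar>poly r (l e + \<mu>)\<bar> \<le> \<bar>M\<bar>"
        using spec[of e "l e"] l[OF e] E(4)[OF e] by force
      ultimately show ?thesis
        by (simp add: abs_mult mult_right_mono)
    qed
    have "(norm (v - x))\<^sup>2 = (\<Sum>e\<in>E. (e \<bullet> (v - x))\<^sup>2)"
      using E by (intro parseval_orthonormal_basis) auto
    also have "\<dots> \<le> (\<Sum>e\<in>E. (M * (e \<bullet> x))\<^sup>2)"
      by (intro sum_mono) (simp add: comp abs_le_square_iff[symmetric])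
    also have "\<dots> = (M * norm x)\<^sup>2"
      using E parseval_orthonormal_basis[of E x]
      by (simp add: power_mult_distrib sum_distrib_left)
    finally have le: "(norm (v - x))\<^sup>2 \<le> (M * norm x)\<^sup>2" .
    \<comment> \<open>The eigenbasis is nonempty, and \<open>M\<close> bounds an absolute value at
      each of its elements.\<close>
    have "0 \<le> M"
    proof -
      obtain e where "e \<in> E"
        using E(3) by (metis UNIV_not_singleton all_not_in_conv span_empty)
      with spec[of e "l e"] l E(4) show ?thesis by force
    qed
    then show ?thesis
      by (intro power2_le_imp_le[OF le]) simp
  qed
  ultimately show ?thesis by blast
qed

lemma ordered_eigenvalues_quadratic_form_le:
  fixes A :: "real^'n^'n"
  assumes sym: "transpose A = A" and ev: "ordered_eigenvalues A \<alpha>"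
  shows "x \<bullet> (A *v x) \<le> \<alpha> 1 * (norm x)\<^sup>2"
proof -
  obtain E l where E: "finite E" "pairwise orthogonal E" "span E = UNIV"
    "\<And>e. e \<in> E \<Longrightarrow> norm e = 1" and l: "\<And>e. e \<in> E \<Longrightarrow> A *v e = l e *\<^sub>R e"
    by (rule symmetric_matrix_eigenbasis[OF sym]) blast
  have x: "(\<Sum>e\<in>E. (x \<bullet> e) *\<^sub>R e) = x"
    using E by (intro orthonormal_basis_expand) auto
  have "x \<bullet> (A *v x) = (\<Sum>e\<in>E. (x \<bullet> e) *\<^sub>R e) \<bullet> (A *v x)"
    by (simp only: x)
  also have "\<dots> = (\<Sum>e\<in>E. l e * (e \<bullet> x)\<^sup>2)"
    unfolding inner_sum_left
    using inner_eigenvector_matrix_power[OF sym l, of _ 1 x]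
    by (intro sum.cong) (simp_all add: power2_eq_square inner_commute)
  also have "\<dots> \<le> (\<Sum>e\<in>E. \<alpha> 1 * (e \<bullet> x)\<^sup>2)"
    using ordered_eigenvalues_bounds(2)[OF ev l] E(4)
    by (intro sum_mono mult_right_mono) force+
  also have "\<dots> = \<alpha> 1 * (norm x)\<^sup>2"
    using E parseval_orthonormal_basis[of E x] by (simp add: sum_distrib_left)
  finally show ?thesis .
qed

text \<open>Positive definiteness is tested on an eigenvector for the smallest eigenvalue. This
  makes the denominator of \<open>\<kappa>\<close> positive.\<close>

lemma ordered_eigenvalues_pos_def_shift:
  fixes A :: "real^'n^'n"
  assumes "ordered_eigenvalues A \<alpha>" "pos_def (A + mat \<mu>)"
  shows "0 < \<alpha> (CARD('n)) + \<mu>"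
proof -
  obtain x where x: "x \<noteq> 0" "A *v x = \<alpha> (CARD('n)) *\<^sub>R x"
    using ordered_eigenvalues_last_eigenvector[OF assms(1)] .
  then have "0 < x \<bullet> ((A + mat \<mu>) *v x)"
    using assms(2) by (simp add: pos_def_def)
  also have "\<dots> = (\<alpha> (CARD('n)) + \<mu>) * (x \<bullet> x)"
    using x by (simp add: matrix_vector_mult_add_rdistrib mat_scaleR_vec inner_add_right
        algebra_simps)
  finally show ?thesis
    using inner_ge_zero[of x] by (simp add: zero_less_mult_iff)
qed

text \<open>Equal norms allow adding \<mu>/2 times the difference of the squared norms, which is
  zero. This turns A into A + \<mu> I in the quadratic part, and inserting g = - (A + \<mu> I) x
  completes the square.\<close>

lemma trs_obj_diff_eq:
  fixes A :: "real^'n^'n"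
  assumes sym: "transpose A = A" and eq: "(A + mat \<mu>) *v x = - g" and n: "norm t = norm x"
  shows "trs_obj A g t - trs_obj A g x = 1 / 2 * ((t - x) \<bullet> ((A + mat \<mu>) *v (t - x)))"
proof -
  have g: "g = - (A *v x) - \<mu> *\<^sub>R x"
    using eq by (simp add: matrix_vector_mult_add_rdistrib mat_scaleR_vec algebra_simps
        eq_neg_iff_add_eq_0)
  have "x \<bullet> (A *v t) = t \<bullet> (A *v x)"
    by (metis sym dot_lmul_matrix vector_transpose_matrix inner_commute)
  moreover have "t \<bullet> t = x \<bullet> x"
    using n by (simp add: dot_square_norm)
  ultimately show ?thesis
    unfolding trs_obj_def g
    by (simp add: matrix_vector_mult_add_rdistrib mat_scaleR_vec matrix_vector_mult_diff_distrib
        inner_add_right inner_diff_left inner_diff_right inner_commute algebra_simps)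
qed

text \<open>Rescaling \<open>v\<close> radially changes it by exactly the difference of the norms;
  \<open>z\<close> supplies a direction when \<open>v = 0\<close>.\<close>

lemma subspace_point_on_sphere_near:
  fixes v :: "'a::real_normed_vector"
  assumes "subspace V" "v \<in> V" "z \<in> V" "z \<noteq> 0" "0 \<le> R"
  obtains u where "u \<in> V" "norm u = R" "norm (u - v) = \<bar>R - norm v\<bar>"
proof (cases "v = 0")
  case True
  with assms show thesis
    by (intro that[of "(R / norm z) *\<^sub>R z"]) (auto intro: subspace_scale)
next
  case False
  have "(R / norm v) *\<^sub>R v - v = ((R - norm v) / norm v) *\<^sub>R v"
    using False by (simp add: diff_divide_distrib scaleR_left_diff_distrib)
  with False assms show thesis
    by (intro that[of "(R / norm v) *\<^sub>R v"]) (auto intro: subspace_scale)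
qed

theorem theorem4p10:
  fixes A :: "real^'n^'n" and g s_opt :: "real^'n" and s :: "nat \<Rightarrow> real^'n"
    and \<Delta> \<mu>_opt \<kappa> :: real and \<alpha> \<mu> :: "nat \<Rightarrow> real" and k :: nat
  assumes "transpose A = A" and "invertible A"
    and "ordered_eigenvalues A \<alpha>"
    and "g \<noteq> 0" and "\<Delta> > 0"
    and "trs_solution A g \<Delta> UNIV s_opt"
    and "trs_multiplier A g \<Delta> s_opt \<mu>_opt"
    and "pos_def (A + mat \<mu>_opt)"
    and "\<And>j. j \<le> lanczos_kmax A g \<Longrightarrow> trs_solution A g \<Delta> (krylov A g j) (s j)"
    and "\<And>j. j \<le> lanczos_kmax A g \<Longrightarrow> trs_multiplier_on (krylov A g j) A g \<Delta> (s j) (\<mu> j)"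
    and "\<And>j. j \<le> lanczos_kmax A g \<Longrightarrow> norm (s j) = \<Delta> \<and> \<mu> j > 0"
    and "k \<le> lanczos_kmax A g"
    and "norm s_opt = \<Delta>" and "norm (s k) = \<Delta>"
    and "\<kappa> = (\<alpha> 1 + \<mu>_opt) / (\<alpha> (CARD('n)) + \<mu>_opt)"
  shows "0 \<le> trs_obj A g (s k) - trs_obj A g s_opt
    \<and> trs_obj A g (s k) - trs_obj A g s_opt
           \<le> 8 * (\<alpha> 1 + \<mu>_opt) * \<Delta>\<^sup>2 * ((sqrt \<kappa> - 1) / (sqrt \<kappa> + 1)) ^ (2 * (k + 1))"
proof
  show "0 \<le> trs_obj A g (s k) - trs_obj A g s_opt"
    using assms(6,14) by (simp add: trs_solution_def)
  define a b \<rho> where "a = \<alpha> 1 + \<mu>_opt" and "b = \<alpha> (CARD('n)) + \<mu>_opt"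
    and "\<rho> = ((sqrt \<kappa> - 1) / (sqrt \<kappa> + 1)) ^ Suc k"
  have b: "0 < b"
    unfolding b_def by (rule ordered_eigenvalues_pos_def_shift[OF assms(3,8)])
  have "\<alpha> (CARD('n)) \<le> \<alpha> 1"
    using assms(3) by (simp add: ordered_eigenvalues_def)
  then have ba: "b \<le> a" by (simp add: a_def b_def)
  obtain r where r: "degree r \<le> Suc k" "poly r 0 = 1"
    and bound: "\<And>x. x \<in> {b..a} \<Longrightarrow> \<bar>poly r x\<bar> \<le> 2 * \<rho>"
    using chebyshev_small_polynomial[OF b ba, of k] assms(15)
    unfolding \<rho>_def a_def b_def by blast
  have eq: "(A + mat \<mu>_opt) *v s_opt = - g"
    using assms(7) by (simp add: trs_multiplier_def)
  have "\<bar>poly r (l + \<mu>_opt)\<bar> \<le> 2 * \<rho>" if "e \<noteq> 0" "A *v e = l *\<^sub>R e" for e l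
    using ordered_eigenvalues_bounds[OF assms(3) that(2,1)]
    by (intro bound) (simp add: a_def b_def)
  then obtain v where v: "v \<in> krylov A g k" "norm (v - s_opt) \<le> 2 * \<rho> * norm s_opt"
    using krylov_polynomial_approximation[OF assms(1) eq _ r] by blast
  \<comment> \<open>The nonzero vector \<open>g\<close> serves as the spare direction in case
    \<open>v = 0\<close>.\<close>
  have "g \<in> krylov A g k"
    unfolding krylov_def by (intro span_base image_eqI[of _ _ 0]) auto
  then obtain u where u: "u \<in> krylov A g k" "norm u = \<Delta>" "norm (u - v) = \<bar>\<Delta> - norm v\<bar>"
    using subspace_point_on_sphere_near[of "krylov A g k" v g \<Delta>] v(1) assms(4,5)
    by (auto simp: krylov_def)
  have "norm (u - s_opt) \<le> norm (u - v) + norm (v - s_opt)"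
    using norm_triangle_ineq[of "u - v" "v - s_opt"] by simp
  also have "\<dots> \<le> 2 * norm (v - s_opt)"
    using norm_triangle_ineq3[of v s_opt] assms(13) u(3) by (simp add: abs_minus_commute)
  also have "\<dots> \<le> 4 * \<rho> * \<Delta>"
    using v(2) assms(13) by (simp add: mult_ac)
  finally have near: "(norm (u - s_opt))\<^sup>2 \<le> (4 * \<rho> * \<Delta>)\<^sup>2"
    by (intro power_mono) auto
  have form: "w \<bullet> ((A + mat \<mu>_opt) *v w) \<le> a * (norm w)\<^sup>2" for w
    using ordered_eigenvalues_quadratic_form_le[OF assms(1,3), of w]
    by (simp add: a_def matrix_vector_mult_add_rdistrib mat_scaleR_vec inner_add_right
        dot_square_norm algebra_simps)
  \<comment> \<open>\<open>u\<close> is feasible for the projected problem, which \<open>s k\<close>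
    solves.\<close>
  have "trs_obj A g (s k) - trs_obj A g s_opt \<le> trs_obj A g u - trs_obj A g s_opt"
    using assms(9)[OF assms(12)] u by (simp add: trs_solution_def)
  also have "\<dots> = 1 / 2 * ((u - s_opt) \<bullet> ((A + mat \<mu>_opt) *v (u - s_opt)))"
    using u(2) assms(13) by (intro trs_obj_diff_eq[OF assms(1) eq]) simp
  also have "\<dots> \<le> 1 / 2 * (a * (norm (u - s_opt))\<^sup>2)"
    using form by (intro mult_left_mono) auto
  also have "\<dots> \<le> 1 / 2 * (a * (4 * \<rho> * \<Delta>)\<^sup>2)"
    using near b ba by (intro mult_left_mono) auto
  \<comment> \<open>The constant is 1/2 * 4^2, where 4 combines the factor 2 of the Chebyshev bound
    with the factor 2 lost in rescaling to the sphere.\<close>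
  also have "\<dots> = 8 * a * \<Delta>\<^sup>2 * \<rho>\<^sup>2"
    by (simp add: power2_eq_square)
  also have "\<rho>\<^sup>2 = ((sqrt \<kappa> - 1) / (sqrt \<kappa> + 1)) ^ (2 * (k + 1))"
    unfolding \<rho>_def by (simp only: power_mult[symmetric] mult.commute Suc_eq_plus1)
  finally show "trs_obj A g (s k) - trs_obj A g s_opt
      \<le> 8 * (\<alpha> 1 + \<mu>_opt) * \<Delta>\<^sup>2 * ((sqrt \<kappa> - 1) / (sqrt \<kappa> + 1)) ^ (2 * (k + 1))"
    by (simp only: a_def)
qed

end
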